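(* Let $a,b,c\in\mathbb R$, let $$\xi=D(\lambda)\frac{\mathrm dz}{z},\qquad D(\lambda)=\begin{pmatrix}c&a\lambda^{-1}+b\lambda\\ a\lambda+b\lambda^{-1}&-c\end{pmatrix}$$ be an $\mathbb R$-equivariant potential on $\mathbb C\setminus\{0\}$, and let $F_\lambda\in\Lambda\mathrm{SU}(2)_\sigma$, $\lambda\in\mathbb S^1$, be the corresponding extended frame, i.e. the unitary factor in the Iwasawa decomposition $\Phi=F_\lambda B$ of $\Phi=\exp(\log z\cdot D)$ (on the universal cover of $\mathbb C\setminus\{0\}$). Then the minimal Lagrangian surface $f^\lambda$ in $Q_2$ constructed from $(F_\lambda,F_{-i\lambda})$ is equivariant: for all $\theta\in\mathbb R$ and $\lambda\in\mathbb S^1$, $$\hat{\mathfrak f}^\lambda(e^{i\theta}z,e^{-i\theta}\bar z,\lambda)=\psi\bigl(\exp(i\theta D(\lambda)),\exp(i\theta D(-i\lambda))\bigr)\,\hat{\mathfrak f}^\lambda(z,\bar z,\lambda),$$ where $\hat{\mathfrak f}^\lambda$ is the horizontal lift of $f^\lambda$ in $\mathbb C^4$.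
   Context: $Q_2=\{[\boldsymbol z]\in\mathbb CP^3:\sum_{k=1}^4z_k^2=0\}$. $\Lambda\mathrm{SL}(2,\mathbb C)_\sigma$ is the (Banach) loop group of maps $g:\mathbb S^1\to\mathrm{SL}(2,\mathbb C)$ with $\sigma_3g(\lambda)\sigma_3=g(-\lambda)$, $\sigma_3=\mathrm{diag}(1,-1)$; $\Lambda\mathrm{SU}(2)_\sigma$ is the subgroup of $\mathrm{SU}(2)$-valued loops, and $\Lambda^+\mathrm{SL}(2,\mathbb C)_\sigma$ the subgroup of loops extending holomorphically to $|\lambda|<1$. Iwasawa decomposition: every $\Phi\in\Lambda\mathrm{SL}(2,\mathbb C)_\sigma$ is uniquely $\Phi=F_\lambda B$ with $F_\lambda\in\Lambda\mathrm{SU}(2)_\sigma$ and $B\in\Lambda^+\mathrm{SL}(2,\mathbb C)_\sigma$ such that $B|_{\lambda=0}$ is diagonal with positive entries. $F_{-i\lambda}$ denotes the value of the loop at $-i\lambda$. Surface: put $X^\lambda=F_\lambda F_{-i\lambda}^{-1}$, $Y^\lambda=iF_\lambda\sigma_3F_{-i\lambda}^{-1}$, $$\hat{\mathfrak f}^\lambda=\tfrac1{\sqrt2}\bigl(\operatorname{Re}X^\lambda_{11}+i\operatorname{Re}Y^\lambda_{11},\operatorname{Im}X^\lambda_{11}+i\operatorname{Im}Y^\lambda_{11},\operatorname{Re}X^\lambda_{12}+i\operatorname{Re}Y^\lambda_{12},\operatorname{Im}X^\lambda_{12}+i\operatorname{Im}Y^\lambda_{12}\bigr)^T\in\mathbb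 C^4,\qquad f^\lambda=[\hat{\mathfrak f}^\lambda].$$ On the universal cover of $\mathbb C\setminus\{0\}$ the rotation $z\mapsto e^{i\theta}z$ means $\log z\mapsto\log z+i\theta$; the notation $g(z,\bar z,\lambda)$ means evaluation at the point $z$ and parameter $\lambda$. $\psi:\mathrm{SU}(2)\times\mathrm{SU}(2)\to\mathrm{SO}(4)$ is the double cover: identify $\mathrm{SU}(2)$ with unit quaternions by $p_0+p_1\boldsymbol i+p_2\boldsymbol j+p_3\boldsymbol k\leftrightarrow\begin{pmatrix}p_0+ip_1&p_2+ip_3\\-p_2+ip_3&p_0-ip_1\end{pmatrix}$ and $\mathbb R^4$ with the quaternions; then $\psi(p,q)x=p\,x\,\bar q$. It acts on $\mathbb C^4$ by complex-linear extension and on loops pointwise in $\lambda$. *)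

theory Defs
  imports "HOL-Analysis.Analysis"
begin

unbundle no fps_syntax

type_synonym mat2 = "complex^2^2"

text \<open>A loop is a function on the complex plane of which only the values on the unit circle
  \<open>sphere 0 1\<close> matter.\<close>

type_synonym loop = "complex \<Rightarrow> mat2"

definition smat :: "complex \<Rightarrow> mat2 \<Rightarrow> mat2" where
  "smat k A = map_matrix (\<lambda>x. k * x) A"

definition mexp :: "mat2 \<Rightarrow> mat2" where
  "mexp A = (\<Sum>n. (1 / fact n) *\<^sub>R (((\<lambda>M. A ** M) ^^ n) (mat 1)))"

definition hconj :: "mat2 \<Rightarrow> mat2" where
  "hconj A = transpose (map_matrix cnj A)"

definition SL2 :: "mat2 set" where
  "SL2 = {A. det A = 1}"

definition SU2 :: "mat2 set" where
  "SU2 = {A \<in> SL2. A ** hconj A = mat 1}"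

definition sigma3 :: mat2 where
  "sigma3 = vector [vector [1, 0], vector [0, -1]]"

text \<open>The Banach structure on loops is the one of the Wiener algebra: every matrix entry has an
  absolutely convergent Fourier series.\<close>

definition wiener :: "(complex \<Rightarrow> complex) \<Rightarrow> bool" where
  "wiener f \<longleftrightarrow> (\<exists>c :: int \<Rightarrow> complex. (\<lambda>n. norm (c n)) summable_on UNIV \<and>
     (\<forall>l \<in> sphere 0 1. ((\<lambda>n. c n * l powi n) has_sum f l) UNIV))"

definition loop_SL :: "loop set" where
  "loop_SL = {g. (\<forall>i j. wiener (\<lambda>l. g l $ i $ j)) \<and>
     (\<forall>l \<in> sphere 0 1. g l \<in> SL2 \<and> sigma3 ** g l ** sigma3 = g (- l))}"

definition loop_SU :: "loop set" where
  "loop_SU = {g \<in> loop_SL. \<forall>l \<in> sphere 0 1. g l \<in> SU2}"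

text \<open>\<open>h\<close> is the holomorphic extension of the loop \<open>g\<close> to the unit disc. As \<open>g\<close> is continuous,
  \<open>h\<close> attains it as continuous boundary values; thus \<open>h\<close> is unique on the closed disc, and
  \<open>det h = 1\<close> there if \<open>g\<close> is a loop in \<open>SL2\<close>.\<close>

definition holo_extension :: "loop \<Rightarrow> loop \<Rightarrow> bool" where
  "holo_extension g h \<longleftrightarrow> (\<forall>l \<in> sphere 0 1. h l = g l) \<and>
     (\<forall>i j. continuous_on (cball 0 1) (\<lambda>l. h l $ i $ j) \<and>
            (\<lambda>l. h l $ i $ j) holomorphic_on ball 0 1)"

definition loop_SL_plus :: "loop set" where
  "loop_SL_plus = {g \<in> loop_SL. \<exists>h. holo_extension g h}"

definition pos_diagonal :: "mat2 \<Rightarrow> bool" where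
  "pos_diagonal A \<longleftrightarrow> (\<forall>i j. i \<noteq> j \<longrightarrow> A $ i $ j = 0) \<and>
     (\<forall>i. \<exists>r > 0. A $ i $ i = complex_of_real r)"

definition iwasawa :: "loop \<Rightarrow> loop \<Rightarrow> loop \<Rightarrow> bool" where
  "iwasawa \<Phi> F B \<longleftrightarrow> F \<in> loop_SU \<and> B \<in> loop_SL_plus \<and>
     (\<forall>l \<in> sphere 0 1. \<Phi> l = F l ** B l) \<and>
     (\<exists>h. holo_extension B h \<and> pos_diagonal (h 0))"

definition Dmat :: "real \<Rightarrow> real \<Rightarrow> real \<Rightarrow> complex \<Rightarrow> mat2" where
  "Dmat a b c l = vector [
     vector [complex_of_real c, complex_of_real a * inverse l + complex_of_real b * l],
     vector [complex_of_real a * l + complex_of_real b * inverse l, - complex_of_real c]]"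

text \<open>The universal cover of the punctured plane is the complex plane with coordinate
  \<open>w = log z\<close> and covering map \<open>exp\<close>. The potential \<open>D dz/z\<close> becomes \<open>D dw\<close> there, with
  holomorphic frame \<open>exp (w D)\<close>, and the rotation \<open>z \<mapsto> e\<^sup>i\<^sup>\<theta> z\<close> becomes \<open>w \<mapsto> w + i \<theta>\<close>.
  A frame is a function of \<open>w\<close> and then of the loop parameter.\<close>

definition holo_frame :: "real \<Rightarrow> real \<Rightarrow> real \<Rightarrow> complex \<Rightarrow> loop" where
  "holo_frame a b c w l = mexp (smat w (Dmat a b c l))"

definition extended_frame :: "real \<Rightarrow> real \<Rightarrow> real \<Rightarrow> (complex \<Rightarrow> loop) \<Rightarrow> bool" where
  "extended_frame a b c F \<longleftrightarrow> (\<forall>w. \<exists>B. iwasawa (holo_frame a b c w) (F w) B)"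

definition Xmat :: "(complex \<Rightarrow> loop) \<Rightarrow> complex \<Rightarrow> complex \<Rightarrow> mat2" where
  "Xmat F l w = F w l ** matrix_inv (F w (- \<i> * l))"

definition Ymat :: "(complex \<Rightarrow> loop) \<Rightarrow> complex \<Rightarrow> complex \<Rightarrow> mat2" where
  "Ymat F l w = smat \<i> (F w l ** sigma3 ** matrix_inv (F w (- \<i> * l)))"

definition fhat :: "(complex \<Rightarrow> loop) \<Rightarrow> complex \<Rightarrow> complex \<Rightarrow> complex^4" where
  "fhat F l w = (let X = Xmat F l w; Y = Ymat F l w in
     (1 / sqrt 2) *\<^sub>R vector [
       Complex (Re (X $ 1 $ 1)) (Re (Y $ 1 $ 1)),
       Complex (Im (X $ 1 $ 1)) (Im (Y $ 1 $ 1)),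
       Complex (Re (X $ 1 $ 2)) (Re (Y $ 1 $ 2)),
       Complex (Im (X $ 1 $ 2)) (Im (Y $ 1 $ 2))])"

text \<open>A point \<open>[v]\<close> of complex projective 3-space is the line spanned by \<open>v \<noteq> 0\<close>.\<close>

definition proj :: "complex^4 \<Rightarrow> (complex^4) set" where
  "proj v = range (\<lambda>k. k *s v)"

definition Q2 :: "(complex^4) set set" where
  "Q2 = {proj v | v. v \<noteq> 0 \<and> (\<Sum>k\<in>UNIV. (v $ k)\<^sup>2) = 0}"

definition surface :: "(complex \<Rightarrow> loop) \<Rightarrow> complex \<Rightarrow> complex \<Rightarrow> (complex^4) set" where
  "surface F l w = proj (fhat F l w)"

definition quat_to_mat :: "real^4 \<Rightarrow> mat2" where
  "quat_to_mat p = vector [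
     vector [Complex (p $ 1) (p $ 2), Complex (p $ 3) (p $ 4)],
     vector [Complex (- (p $ 3)) (p $ 4), Complex (p $ 1) (- (p $ 2))]]"

definition mat_to_quat :: "mat2 \<Rightarrow> real^4" where
  "mat_to_quat A = vector [Re (A $ 1 $ 1), Im (A $ 1 $ 1), Re (A $ 1 $ 2), Im (A $ 1 $ 2)]"

text \<open>\<open>x \<mapsto> p x q\<^sup>*\<close>, with quaternions represented by matrices; quaternionic
  conjugation is the Hermitian transpose.\<close>

definition psi :: "mat2 \<Rightarrow> mat2 \<Rightarrow> real^4 \<Rightarrow> real^4" where
  "psi p q x = mat_to_quat (p ** quat_to_mat x ** hconj q)"

text \<open>The complex-linear extension \<open>x + i y \<mapsto> psi p q x + i psi p q y\<close>.\<close>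

definition psiC :: "mat2 \<Rightarrow> mat2 \<Rightarrow> complex^4 \<Rightarrow> complex^4" where
  "psiC p q v = (\<chi> k. Complex (psi p q (\<chi> j. Re (v $ j)) $ k) (psi p q (\<chi> j. Im (v $ j)) $ k))"

end

theory Submission
  imports Defs "HOL-Complex_Analysis.Conformal_Mappings"
begin

text \<open>On the unit circle \<open>D\<close> is Hermitian and traceless, so \<open>U = exp (i \<theta> D)\<close> is unitary of
  determinant one, and \<open>\<Phi> (w + i \<theta>) = U \<Phi> w = (U F w) B\<close>. Two factorisations of the same loop
  have the same unitary factor: \<open>B' B\<^sup>-\<^sup>1 = F'\<^sup>-\<^sup>1 F\<close> extends holomorphically to the disc and is
  unitary on the circle, so its entries are conjugate in pairs there, hence constant, and its
  value at \<open>0\<close> is positive diagonal. Therefore \<open>F (w + i \<theta>) = U F w\<close>, and \<open>X\<close> and \<open>Y\<close>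
  are multiplied by \<open>U\<close> at \<open>\<lambda>\<close> from the left and by the inverse of \<open>U\<close> at \<open>-i \<lambda>\<close> from the
  right, which is the action of \<open>\<psi>\<close>.\<close>

section \<open>Two-by-two matrices: adjugate, Hermitian transpose and SU(2)\<close>

lemmas mat2_simps = vec_eq_iff forall_2 sum_2 matrix_matrix_mult_def mat_def map_matrix_def
  smat_def hconj_def transpose_def

text \<open>The adjugate. It inverts matrices of determinant 1 and is linear in the entries, so it
  keeps holomorphy and continuity. The equation \<open>hconj A = adj2 A\<close> characterises the
  matrices that represent quaternions.\<close>

definition adj2 :: "mat2 \<Rightarrow> mat2" where
  "adj2 A = vector [vector [A $ 2 $ 2, - (A $ 1 $ 2)], vector [- (A $ 2 $ 1), A $ 1 $ 1]]"

lemma adj2_nth [simp]: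
  "adj2 A $ 1 $ 1 = A $ 2 $ 2" "adj2 A $ 1 $ 2 = - (A $ 1 $ 2)"
  "adj2 A $ 2 $ 1 = - (A $ 2 $ 1)" "adj2 A $ 2 $ 2 = A $ 1 $ 1"
  by (simp_all add: adj2_def)

lemma mult_adj2: "A ** adj2 A = smat (det A) (mat 1)" "adj2 A ** A = smat (det A) (mat 1)"
  by (simp_all add: mat2_simps det_2 algebra_simps)

lemma adj2_mult: "adj2 (A ** B) = adj2 B ** adj2 A"
  by (simp add: mat2_simps algebra_simps)

lemma hconj_mult: "hconj (A ** B) = hconj B ** hconj A"
  by (simp add: mat2_simps algebra_simps)

lemma matrix_add_rdistrib: "(A + B) ** C = A ** C + B ** (C :: mat2)"
  by (simp add: mat2_simps algebra_simps)

lemma smat_1 [simp]: "smat 1 A = A"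
  by (simp add: mat2_simps)

lemma smat_mult [simp]: "smat k A ** B = smat k (A ** B)" "A ** smat k B = smat k (A ** B)"
  by (simp_all add: mat2_simps algebra_simps)

text \<open>Both \<open>hconj\<close> and \<open>adj2\<close> reverse products, so in this form
  closure under multiplication is immediate.\<close>

lemma SU2_iff: "A \<in> SU2 \<longleftrightarrow> det A = 1 \<and> hconj A = adj2 A"
proof -
  have "hconj A = adj2 A" if "det A = 1" "A ** hconj A = mat 1"
  proof -
    have "adj2 A = adj2 A ** A ** hconj A"
      by (simp add: that flip: matrix_mul_assoc)
    thus ?thesis by (simp add: mult_adj2 that)
  qed
  thus ?thesis by (auto simp: SU2_def SL2_def mult_adj2)
qed

lemma SU2_mult: "A \<in> SU2 \<Longrightarrow> B \<in> SU2 \<Longrightarrow> A ** B \<in> SU2"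
  by (simp add: SU2_iff det_mul hconj_mult adj2_mult)

lemma hconj_SU2:
  assumes "A \<in> SU2"
  shows "A ** hconj A = mat 1" "hconj A ** A = mat 1" "hconj A \<in> SU2"
proof -
  have "det (hconj A) = det A" "hconj (hconj A) = adj2 (hconj A)"
    using assms by (auto simp: SU2_iff det_2 mat2_simps mult.commute)
  thus "A ** hconj A = mat 1" "hconj A ** A = mat 1" "hconj A \<in> SU2"
    using assms by (simp_all add: SU2_iff mult_adj2)
qed

lemma matrix_inv_SU2:
  assumes "A \<in> SU2"
  shows "matrix_inv A = hconj A"
  unfolding matrix_inv_def
proof (rule some_equality)
  fix A' assume "A ** A' = mat 1 \<and> A' ** A = mat 1"
  thus "A' = hconj A"
    by (metis assms hconj_SU2(1) matrix_mul_assoc matrix_mul_lid matrix_mul_rid)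
qed (simp add: assms hconj_SU2)

section \<open>The exponential of a traceless matrix\<close>

text \<open>The entire function \<open>sinh t / t\<close> with its removable singularity filled in;
  it covers nilpotent matrices by the same formula as the others.\<close>

definition sinhc :: "complex \<Rightarrow> complex" where
  "sinhc t = (if t = 0 then 1 else sinh t / t)"

lemma mult_sinhc: "t * sinhc t = sinh t"
  by (simp add: sinhc_def)

text \<open>Even powers of \<open>A\<close> are multiples of the identity and odd powers are
  multiples of \<open>A\<close>, so the exponential series splits into the series of
  \<open>cosh\<close> and \<open>sinhc\<close>.\<close>

lemma mexp_eq:
  assumes "A ** A = smat (t\<^sup>2) (mat 1)"
  shows "mexp A = smat (cosh t) (mat 1) + smat (sinhc t) A"
proof -
  define P where "P n = (((\<lambda>M. A ** M) ^^ n) (mat 1))" for n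
  have P_Suc: "P (Suc n) = A ** P n" for n by (simp add: P_def)
  have "(\<lambda>n. (1 / fact n) *\<^sub>R P n) sums (smat (cosh t) (mat 1) + smat (sinhc t) A)"
  proof (cases "t = 0")
    case True
    \<comment> \<open>Here \<open>A ** A = 0\<close>, so the series stops after the linear
      term.\<close>
    have P2: "P (Suc (Suc n)) = 0" for n
      using assms True by (simp add: P_Suc matrix_mul_assoc) (simp add: mat2_simps)
    have "P n = 0" if n: "n \<notin> {..<2}" for n
    proof -
      obtain m where "n = 2 + m"
        using n le_Suc_ex[of 2 n] by (auto simp: not_less)
      thus ?thesis by (simp add: P2)
    qed
    hence "(\<lambda>n. (1 / fact n) *\<^sub>R P n) sums (\<Sum>n<2. (1 / fact n) *\<^sub>R P n)"
      by (intro sums_finite) auto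
    moreover have "(\<Sum>n<2. (1 / fact n) *\<^sub>R P n) = mat 1 + A"
      by (simp add: numeral_2_eq_2 P_def)
    ultimately show ?thesis using True by (simp add: sinhc_def)
  next
    case False
    \<comment> \<open>The two coefficients are the even part of \<open>t ^ n\<close> and the odd
      part divided by \<open>t\<close>; they vanish for odd and even \<open>n\<close>
      respectively.\<close>
    have P: "P n = smat ((t ^ n + (- t) ^ n) / 2) (mat 1) + smat ((t ^ n - (- t) ^ n) / (2 * t)) A" for n
    proof (induction n)
      case 0
      show ?case by (simp add: P_def mat2_simps)
    next
      case (Suc n)
      have "A ** A = smat (t * t) (mat 1)" using assms by (simp add: power2_eq_square)
      thus ?case using False
        by (simp add: P_Suc Suc matrix_add_ldistrib) (simp add: mat2_simps field_simps)
    qed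
    have e: "(\<lambda>n. s ^ n / fact n) sums exp s" for s :: complex
      using exp_converges[of s] by (simp add: scaleR_conv_of_real field_simps)
    have C: "(\<lambda>n. (t ^ n + (- t) ^ n) / 2 / fact n) sums cosh t"
      using sums_divide[OF sums_add[OF e[of t] e[of "- t"]], of 2]
      by (simp add: cosh_field_def add_divide_distrib mult.commute)
    have S: "(\<lambda>n. (t ^ n - (- t) ^ n) / (2 * t) / fact n) sums sinhc t"
      using sums_divide[OF sums_diff[OF e[of t] e[of "- t"]], of "2 * t"] False
      by (simp add: sinh_field_def sinhc_def diff_divide_distrib mult.commute)
    have "(\<lambda>n. ((1 / fact n) *\<^sub>R P n) $ i $ j) sums
      ((smat (cosh t) (mat 1) + smat (sinhc t) A) $ i $ j)" for i j
    proof -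
      have "((1 / fact n) *\<^sub>R P n) $ i $ j = (t ^ n + (- t) ^ n) / 2 / fact n * mat 1 $ i $ j
        + (t ^ n - (- t) ^ n) / (2 * t) / fact n * A $ i $ j" for n
        by (simp add: P smat_def map_matrix_def, simp add: scaleR_conv_of_real add_divide_distrib)
      thus ?thesis
        using sums_add[OF sums_mult2[OF C, of "mat 1 $ i $ j"] sums_mult2[OF S, of "A $ i $ j"]]
        by (simp add: smat_def map_matrix_def)
    qed
    thus ?thesis by (auto simp: sums_def intro!: vec_tendstoI)
  qed
  thus ?thesis unfolding mexp_def P_def by (rule sums_unique[symmetric])
qed

lemma mexp_smat:
  assumes "D ** D = smat (s\<^sup>2) (mat 1)"
  shows "mexp (smat w D) = smat (cosh (w * s)) (mat 1) + smat (w * sinhc (w * s)) D"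
proof -
  have "smat w D ** smat w D = smat ((w * s)\<^sup>2) (mat 1)"
    by (simp add: assms) (simp add: mat2_simps power2_eq_square)
  from mexp_eq[OF this] show ?thesis by (simp add: mat2_simps algebra_simps)
qed

text \<open>The coefficients of the identity and of \<open>D\<close> obey the addition theorems of
  \<open>cosh\<close> and \<open>sinh\<close>.\<close>

lemma mexp_smat_add:
  assumes "D ** D = smat (s\<^sup>2) (mat 1)"
  shows "mexp (smat (v + w) D) = mexp (smat v D) ** mexp (smat w D)"
proof -
  define C where "C w = cosh (w * s)" for w
  define S where "S w = w * sinhc (w * s)" for w
  have C: "C (v + w) = C v * C w + S v * S w * s\<^sup>2"
    by (simp add: C_def S_def distrib_right cosh_add flip: mult_sinhc) (simp add: power2_eq_square algebra_simps)
  have S: "S (v + w) = S v * C w + C v * S w"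
  proof (cases "s = 0")
    case False
    \<comment> \<open>The addition theorem of \<open>sinh\<close> gives the claim multiplied by
      \<open>s\<close>. For \<open>s = 0\<close> the functions degenerate to \<open>S w = w\<close>
      and \<open>C w = 1\<close>.\<close>
    have sinh: "S w * s = sinh (w * s)" for w
      using mult_sinhc[of "w * s"] by (simp add: S_def algebra_simps)
    have "S (v + w) * s = S v * s * C w + C v * (S w * s)"
      by (simp only: sinh C_def distrib_right sinh_add)
    hence "S (v + w) * s = (S v * C w + C v * S w) * s"
      by (simp only: distrib_left distrib_right mult.assoc mult.commute[of _ s] mult.left_commute[of _ s])
    thus ?thesis using False by simp
  qed (simp add: S_def C_def sinhc_def)
  have "mexp (smat v D) ** mexp (smat w D)
    = smat (C v * C w) (mat 1) + smat (S v * C w + C v * S w) D + smat (S v * S w) (D ** D)"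
    by (simp add: mexp_smat[OF assms] flip: C_def S_def) (simp add: mat2_simps algebra_simps)
  also have "\<dots> = smat (C (v + w)) (mat 1) + smat (S (v + w)) D"
    unfolding assms C S by (simp add: mat2_simps algebra_simps)
  finally show ?thesis by (simp add: mexp_smat[OF assms] C_def S_def)
qed

text \<open>Adjugate and Hermitian transpose of the exponential are both the exponential at the
  opposite argument: the first because \<open>D\<close> is traceless, the second because
  \<open>D\<close> is Hermitian and \<open>r\<close> is real.\<close>

lemma mexp_imaginary_SU2:
  assumes D: "D ** D = smat ((complex_of_real r)\<^sup>2) (mat 1)"
    and tr: "D $ 2 $ 2 = - (D $ 1 $ 1)" and herm: "hconj D = D"
  shows "mexp (smat (\<i> * complex_of_real \<theta>) D) \<in> SU2"
proof -
  let ?U = "\<lambda>w. mexp (smat w D)"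
  let ?w = "\<i> * complex_of_real \<theta>"
  \<comment> \<open>The adjugate fixes the identity and negates the traceless \<open>D\<close>,
    while \<open>cosh\<close> and \<open>sinhc\<close> are even.\<close>
  have adj: "adj2 (?U w) = ?U (- w)" for w
    unfolding mexp_smat[OF D] using tr by (simp add: mat2_simps sinhc_def)
  have "?U w ** adj2 (?U w) = mat 1" for w
    unfolding adj using mexp_smat_add[OF D, of w "- w"] mexp_smat[OF D, of 0]
    by (simp add: mat2_simps)
  hence "det (?U w) = 1" for w
    using mult_adj2(1)[of "?U w"] by (simp add: mat2_simps)
  moreover have "hconj (?U ?w) = ?U (- ?w)"
  proof -
    have cosh: "cnj (cosh t) = cosh (cnj t)" and "cnj (sinh t) = sinh (cnj t)" for t
      by (simp_all add: cosh_field_def sinh_field_def exp_cnj)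
    hence sinhc: "cnj (sinhc t) = sinhc (cnj t)" for t
      by (simp add: sinhc_def)
    have "cnj (D $ 1 $ 1) = D $ 1 $ 1" "cnj (D $ 2 $ 2) = D $ 2 $ 2"
      "cnj (D $ 1 $ 2) = D $ 2 $ 1" "cnj (D $ 2 $ 1) = D $ 1 $ 2"
      using herm by (simp_all add: mat2_simps)
    thus ?thesis unfolding mexp_smat[OF D] by (simp add: mat2_simps cosh sinhc)
  qed
  ultimately show ?thesis by (simp add: SU2_iff adj)
qed

section \<open>The potential on the unit circle\<close>

lemma inverse_unit_circle: "l \<in> sphere 0 1 \<Longrightarrow> inverse l = cnj (l :: complex)"
  by (metis complex_norm_square inverse_unique mem_sphere_0 of_real_1 one_power2)

text \<open>On the circle the off-diagonal entries are conjugates \<open>u\<close> and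
  \<open>cnj u\<close>, so \<open>D\<close> squares to the nonnegative real scalar
  \<open>c^2 + |u|^2\<close>, whose root is \<open>r\<close>.\<close>

lemma Dmat_unit_circle:
  assumes "l \<in> sphere 0 1"
  obtains r where "Dmat a b c l ** Dmat a b c l = smat ((complex_of_real r)\<^sup>2) (mat 1)"
    "Dmat a b c l $ 2 $ 2 = - (Dmat a b c l $ 1 $ 1)" "hconj (Dmat a b c l) = Dmat a b c l"
proof
  define u where "u = complex_of_real a * cnj l + complex_of_real b * l"
  have D: "Dmat a b c l = vector [vector [complex_of_real c, u], vector [cnj u, - complex_of_real c]]"
    using inverse_unit_circle[OF assms] by (simp add: Dmat_def u_def)
  have "(complex_of_real (sqrt (c\<^sup>2 + (cmod u)\<^sup>2)))\<^sup>2 = complex_of_real (c\<^sup>2 + (cmod u)\<^sup>2)"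
    by (simp flip: of_real_power)
  also have "\<dots> = complex_of_real c * complex_of_real c + u * cnj u"
    by (simp add: power2_eq_square flip: complex_norm_square)
  finally show "Dmat a b c l ** Dmat a b c l = smat ((complex_of_real (sqrt (c\<^sup>2 + (cmod u)\<^sup>2)))\<^sup>2) (mat 1)"
    by (simp add: D mat2_simps)
  show "Dmat a b c l $ 2 $ 2 = - (Dmat a b c l $ 1 $ 1)" "hconj (Dmat a b c l) = Dmat a b c l"
    by (simp_all add: D mat2_simps)
qed

section \<open>Uniqueness of the unitary factor\<close>

text \<open>The maximum principle makes \<open>f\<close> real on the whole disc, and a nonconstant
  holomorphic function is open.\<close>

lemma real_on_circle_imp_const:
  assumes holf: "f holomorphic_on ball 0 1" and contf: "continuous_on (cball 0 1) f"
    and real: "\<And>l. l \<in> sphere 0 1 \<Longrightarrow> Im (f l) = 0" and z: "z \<in> cball 0 1"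
  shows "f z = f 0"
proof -
  have Im0: "Im (f z) = 0" if z: "z \<in> cball 0 1" for z
  proof (rule antisym)
    \<comment> \<open>Taking \<open>k = -i\<close> and \<open>k = i\<close> bounds
      \<open>Im f\<close> from above and from below.\<close>
    have "Re (k * f z) \<le> 0" if k: "Re k = 0" for k
    proof (rule maximum_real_frontier[of "\<lambda>z. k * f z" "cball 0 1" 0 z])
      show "(\<lambda>z. k * f z) holomorphic_on interior (cball 0 1)"
        by (simp add: holf holomorphic_on_mult)
      show "continuous_on (closure (cball 0 1)) (\<lambda>z. k * f z)"
        by (simp add: contf continuous_on_mult)
    qed (use z k real in auto)
    from this[of "- \<i>"] this[of "\<i>"]
    show "Im (f z) \<le> 0" "0 \<le> Im (f z)" by simp_all
  qed
  have "f constant_on ball 0 1"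
  proof (rule ccontr)
    assume "\<not> ?thesis"
    hence "open (f ` ball 0 1)"
      by (intro open_mapping_thm[OF holf]) auto
    moreover have "f 0 \<in> f ` ball 0 1" by simp
    ultimately obtain e where e: "e > 0" "ball (f 0) e \<subseteq> f ` ball 0 1"
      by (meson openE)
    \<comment> \<open>A non-real point near \<open>f 0\<close>, which an open image would have to
      contain.\<close>
    have "f 0 + \<i> * (e / 2) \<in> ball (f 0) e"
      using e(1) by (simp add: dist_norm norm_mult)
    with e(2) have "f 0 + \<i> * (e / 2) \<in> f ` ball 0 1" by (rule subsetD)
    then obtain y where "y \<in> ball 0 1" "f 0 + \<i> * (e / 2) = f y" by (rule imageE)
    thus False using Im0[of y] Im0[of 0] e(1) by (auto simp: complex_eq_iff)
  qed
  then obtain y where y: "\<And>w. w \<in> ball 0 1 \<Longrightarrow> f w = y"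
    unfolding constant_on_def by blast
  have "f z = y"
    by (rule continuous_constant_on_closure[of "ball 0 1"]) (use contf y z in simp_all)
  moreover have "f 0 = y" by (rule y) simp
  ultimately show ?thesis by simp
qed

text \<open>On the circle \<open>f + g\<close> is twice the real part of \<open>f\<close>, and
  \<open>i (f - g)\<close> is minus twice its imaginary part; both are real there.\<close>

lemma cnj_on_circle_imp_const:
  assumes "f holomorphic_on ball 0 1" "continuous_on (cball 0 1) f"
    and "g holomorphic_on ball 0 1" "continuous_on (cball 0 1) g"
    and g: "\<And>l. l \<in> sphere 0 1 \<Longrightarrow> g l = cnj (f l)" and z: "z \<in> cball 0 1"
  shows "f z = f 0"
proof -
  have "f z + g z = f 0 + g 0"
    by (rule real_on_circle_imp_const[of "\<lambda>z. f z + g z"])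
       (use assms in \<open>auto intro!: holomorphic_intros continuous_intros\<close>)
  moreover have "\<i> * (f z - g z) = \<i> * (f 0 - g 0)"
    by (rule real_on_circle_imp_const[of "\<lambda>z. \<i> * (f z - g z)"])
       (use assms in \<open>auto intro!: holomorphic_intros continuous_intros\<close>)
  hence "f z - g z = f 0 - g 0" by simp
  ultimately have "(f z + g z) + (f z - g z) = (f 0 + g 0) + (f 0 - g 0)" by simp
  thus ?thesis by simp
qed

lemma iwasawa_unitary_unique:
  assumes F: "\<And>l. l \<in> sphere 0 1 \<Longrightarrow> F l \<in> SU2" and F': "\<And>l. l \<in> sphere 0 1 \<Longrightarrow> F' l \<in> SU2"
    and B: "\<And>l. l \<in> sphere 0 1 \<Longrightarrow> det (B l) = 1"
    and h: "holo_extension B h" "pos_diagonal (h 0)"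
    and h': "holo_extension B' h'" "pos_diagonal (h' 0)"
    and eq: "\<And>l. l \<in> sphere 0 1 \<Longrightarrow> F l ** B l = F' l ** B' l"
    and l: "l \<in> sphere 0 1"
  shows "F l = F' l"
proof -
  \<comment> \<open>With the adjugate in place of the inverse, \<open>G\<close> is visibly
    holomorphic on the disc; on the circle it is the quotient of \<open>B'\<close> by
    \<open>B\<close>.\<close>
  define G where "G z = h' z ** adj2 (h z)" for z
  have G_circle: "G l = hconj (F' l) ** F l" if l: "l \<in> sphere 0 1" for l
  proof -
    have "G l = hconj (F' l) ** F' l ** B' l ** adj2 (B l)"
      using l h(1) h'(1) F'[OF l] by (simp add: G_def holo_extension_def hconj_SU2)
    also have "\<dots> = hconj (F' l) ** F l ** (B l ** adj2 (B l))"
      by (metis eq[OF l] matrix_mul_assoc)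
    finally show ?thesis by (simp add: mult_adj2 B[OF l])
  qed
  hence G_SU2: "G l \<in> SU2" if "l \<in> sphere 0 1" for l
    using that F F' by (simp add: SU2_mult hconj_SU2(3))
  have adj: "(\<lambda>z. adj2 (h z) $ i $ j) holomorphic_on ball 0 1"
    "continuous_on (cball 0 1) (\<lambda>z. adj2 (h z) $ i $ j)" for i j
    using h(1) exhaust_2[of i] exhaust_2[of j]
    by (auto simp: holo_extension_def simp del: vector_uminus_component
        intro!: holomorphic_on_minus continuous_on_minus)
  have G_nth: "G z $ i $ j = h' z $ i $ 1 * adj2 (h z) $ 1 $ j + h' z $ i $ 2 * adj2 (h z) $ 2 $ j"
    for z i j by (simp add: G_def matrix_matrix_mult_def sum_2)
  have hol: "(\<lambda>z. G z $ i $ j) holomorphic_on ball 0 1" for i j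
    unfolding G_nth using h'(1)
    by (intro holomorphic_on_add holomorphic_on_mult adj) (simp_all add: holo_extension_def)
  have cont: "continuous_on (cball 0 1) (\<lambda>z. G z $ i $ j)" for i j
    unfolding G_nth using h'(1)
    by (intro continuous_on_add continuous_on_mult adj) (simp_all add: holo_extension_def)
  have circle: "G l $ 2 $ 2 = cnj (G l $ 1 $ 1)" "- (G l $ 2 $ 1) = cnj (G l $ 1 $ 2)"
    if "l \<in> sphere 0 1" for l
    using G_SU2[OF that] by (auto simp: SU2_iff mat2_simps)
  have "G l $ 1 $ 1 = G 0 $ 1 $ 1"
    using cnj_on_circle_imp_const[OF hol cont hol cont circle(1), of l] l by simp
  moreover have "G l $ 1 $ 2 = G 0 $ 1 $ 2"
    using cnj_on_circle_imp_const[OF hol cont holomorphic_on_minus[OF hol]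
        continuous_on_minus[OF cont] circle(2), of l] l by simp
  moreover have "\<exists>r>0. G 0 $ 1 $ 1 = complex_of_real r"
  proof -
    \<comment> \<open>The adjugate swaps the diagonal, so the entry of \<open>h 0\<close> that
      enters here is the lower one.\<close>
    obtain r s where "r > 0" "s > 0" "h' 0 $ 1 $ 1 = complex_of_real r" "h 0 $ 2 $ 2 = complex_of_real s"
      using h(2) h'(2) unfolding pos_diagonal_def by meson
    moreover have "h' 0 $ 1 $ 2 = 0" using h'(2) by (simp add: pos_diagonal_def)
    ultimately show ?thesis
      by (intro exI[of _ "r * s"]) (simp add: G_def matrix_matrix_mult_def sum_2)
  qed
  moreover have "G 0 $ 1 $ 2 = 0"
    using h(2) h'(2) by (simp add: G_def matrix_matrix_mult_def sum_2 pos_diagonal_def)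
  ultimately obtain r where r: "r > 0" "G l $ 1 $ 1 = complex_of_real r" and G12: "G l $ 1 $ 2 = 0"
    by auto
  \<comment> \<open>Both diagonal entries of \<open>G l\<close> equal \<open>r\<close>, and its
    determinant is 1.\<close>
  have "complex_of_real (r * r) = 1"
    using G_SU2[OF l] circle[OF l] r G12 by (simp add: SU2_iff det_2)
  hence "r * r = 1" using of_real_eq_1_iff by blast
  hence "r = 1" using r(1) by (metis abs_of_pos abs_1 real_sqrt_abs2 real_sqrt_one)
  hence "G l = mat 1"
    using circle[OF l] r G12 by (simp add: mat2_simps)
  hence "F' l ** (hconj (F' l) ** F l) = F' l" by (simp add: G_circle[OF l])
  thus ?thesis by (simp add: matrix_mul_assoc hconj_SU2(1)[OF F'[OF l]])
qed

section \<open>Rotation of the extended frame\<close>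

lemma extended_frame_SU2:
  assumes "extended_frame a b c F" "l \<in> sphere 0 1"
  shows "F w l \<in> SU2"
  using assms unfolding extended_frame_def iwasawa_def loop_SU_def by blast

lemma extended_frame_rotate:
  assumes F: "extended_frame a b c F" and l: "l \<in> sphere 0 1"
  shows "F (w + \<i> * complex_of_real \<theta>) l
    = mexp (smat (\<i> * complex_of_real \<theta>) (Dmat a b c l)) ** F w l"
proof -
  define U where "U l = mexp (smat (\<i> * complex_of_real \<theta>) (Dmat a b c l))" for l
  have U: "U l \<in> SU2" and U_holo: "holo_frame a b c (w + \<i> * complex_of_real \<theta>) l = U l ** holo_frame a b c w l"
    if l: "l \<in> sphere 0 1" for l
  proof -
    obtain r where D: "Dmat a b c l ** Dmat a b c l = smat ((complex_of_real r)\<^sup>2) (mat 1)"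
      "Dmat a b c l $ 2 $ 2 = - (Dmat a b c l $ 1 $ 1)" "hconj (Dmat a b c l) = Dmat a b c l"
      using Dmat_unit_circle[OF l] .
    show "U l \<in> SU2" unfolding U_def by (rule mexp_imaginary_SU2[OF D])
    show "holo_frame a b c (w + \<i> * complex_of_real \<theta>) l = U l ** holo_frame a b c w l"
      unfolding U_def holo_frame_def by (metis mexp_smat_add[OF D(1)] add.commute)
  qed
  obtain B where B: "iwasawa (holo_frame a b c w) (F w) B"
    using F unfolding extended_frame_def by blast
  obtain B' where B': "iwasawa (holo_frame a b c (w + \<i> * complex_of_real \<theta>)) (F (w + \<i> * complex_of_real \<theta>)) B'"
    using F unfolding extended_frame_def by blast
  obtain h where h: "holo_extension B h" "pos_diagonal (h 0)"
    using B unfolding iwasawa_def by blast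
  obtain h' where h': "holo_extension B' h'" "pos_diagonal (h' 0)"
    using B' unfolding iwasawa_def by blast
  have "F (w + \<i> * complex_of_real \<theta>) l = U l ** F w l"
  \<comment> \<open>The rotated frame takes the first place, so the determinant condition falls on
    \<open>B'\<close>.\<close>
  proof (rule iwasawa_unitary_unique[OF _ _ _ h' h _ l])
    fix l :: complex assume l: "l \<in> sphere 0 1"
    show "F (w + \<i> * complex_of_real \<theta>) l \<in> SU2" "U l ** F w l \<in> SU2"
      using extended_frame_SU2[OF F l] U[OF l] by (auto intro: SU2_mult)
    show "det (B' l) = 1"
      using B' l by (simp add: iwasawa_def loop_SL_plus_def loop_SL_def SL2_def)
    show "F (w + \<i> * complex_of_real \<theta>) l ** B' l = U l ** F w l ** B l"
      using B B' l U_holo[OF l] by (simp add: iwasawa_def flip: matrix_mul_assoc)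
  qed
  thus ?thesis by (simp add: U_def)
qed

section \<open>The lift and the quadric\<close>

lemma vector_4:
  "(vector [x, y, z, u] :: 'a::zero^4) $ 1 = x" "(vector [x, y, z, u] :: 'a^4) $ 2 = y"
  "(vector [x, y, z, u] :: 'a^4) $ 3 = z" "(vector [x, y, z, u] :: 'a^4) $ 4 = u"
  by (simp_all add: vector_def)

lemma mat_to_quat_nth [simp]:
  "mat_to_quat A $ 1 = Re (A $ 1 $ 1)" "mat_to_quat A $ 2 = Im (A $ 1 $ 1)"
  "mat_to_quat A $ 3 = Re (A $ 1 $ 2)" "mat_to_quat A $ 4 = Im (A $ 1 $ 2)"
  by (simp_all add: mat_to_quat_def vector_4)

lemma quaternionic_nth:
  assumes "hconj A = adj2 A"
  shows "A $ 2 $ 2 = cnj (A $ 1 $ 1)" "A $ 2 $ 1 = - cnj (A $ 1 $ 2)"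
  using assms by (simp_all add: mat2_simps)

text \<open>\<open>mat_to_quat\<close> reads only the first row; for a quaternionic matrix this row
  determines the second.\<close>

lemma quat_to_mat_mat_to_quat:
  assumes "hconj A = adj2 A"
  shows "quat_to_mat (mat_to_quat A) = A"
  by (simp add: quat_to_mat_def vec_eq_iff forall_2 quaternionic_nth[OF assms] complex_eq_iff)

text \<open>\<open>smat \<i> sigma3\<close> is the quaternion unit i. Absorbing the factor into
  \<open>sigma3\<close> shows that \<open>Ymat\<close> is a product of quaternionic
  matrices.\<close>

lemma hconj_i_sigma3: "hconj (smat \<i> sigma3) = adj2 (smat \<i> sigma3)"
  by (simp add: sigma3_def mat2_simps)

lemma Xmat_eq:
  assumes "F w l \<in> SU2" "F w (- \<i> * l) \<in> SU2"
  shows "Xmat F l w = F w l ** hconj (F w (- \<i> * l))"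
  using assms by (simp add: Xmat_def matrix_inv_SU2)

lemma Ymat_eq:
  assumes "F w l \<in> SU2" "F w (- \<i> * l) \<in> SU2"
  shows "Ymat F l w = F w l ** smat \<i> sigma3 ** hconj (F w (- \<i> * l))"
  using assms by (simp add: Ymat_def matrix_inv_SU2)

lemma quaternionic_X_Y:
  assumes "F w l \<in> SU2" "F w (- \<i> * l) \<in> SU2"
  shows "hconj (Xmat F l w) = adj2 (Xmat F l w)" "hconj (Ymat F l w) = adj2 (Ymat F l w)"
  unfolding Xmat_eq[of F w l, OF assms] Ymat_eq[of F w l, OF assms]
  using assms(1) hconj_SU2(3)[OF assms(2)]
  by (simp_all only: SU2_iff hconj_mult adj2_mult hconj_i_sigma3)

lemma fhat_nth:
  "fhat F l w $ k = (1 / sqrt 2) *\<^sub>R Complex (mat_to_quat (Xmat F l w) $ k) (mat_to_quat (Ymat F l w) $ k)"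
  using exhaust_4[of k] by (auto simp: fhat_def Let_def vector_4)

text \<open>For quaternionic matrices the form \<open>\<Sum> v\<^sub>k\<^sup>2\<close> is the complexified determinant of
  \<open>X + i Y\<close>, and \<open>X + i Y = F (1 - \<sigma>\<^sub>3) F'\<^sup>-\<^sup>1\<close> is singular.\<close>

lemma sum_power2_fhat:
  assumes "F w l \<in> SU2" "F w (- \<i> * l) \<in> SU2"
  shows "(\<Sum>k\<in>UNIV. (fhat F l w $ k)\<^sup>2) = 0"
proof -
  let ?X = "Xmat F l w" and ?Y = "Ymat F l w"
  have half: "(complex_of_real (1 / sqrt 2))\<^sup>2 = 1 / 2"
    by (simp add: power_divide flip: of_real_power)
  have "(\<Sum>k\<in>UNIV. (fhat F l w $ k)\<^sup>2)
    = (\<Sum>k\<in>UNIV. (Complex (mat_to_quat ?X $ k) (mat_to_quat ?Y $ k))\<^sup>2) / 2"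
    by (simp only: fhat_nth scaleR_conv_of_real power_mult_distrib half sum_distrib_left[symmetric])
      simp
  also have "(\<Sum>k\<in>UNIV. (Complex (mat_to_quat ?X $ k) (mat_to_quat ?Y $ k))\<^sup>2) = det (?X + smat \<i> ?Y)"
  proof -
    note nth = quaternionic_X_Y[of F w l, OF assms, THEN quaternionic_nth(1)]
      quaternionic_X_Y[of F w l, OF assms, THEN quaternionic_nth(2)]
    show ?thesis
      by (simp add: nth sum_4 det_2 smat_def map_matrix_def complex_eq_iff
          power2_eq_square algebra_simps)
  qed
  also have "?X + smat \<i> ?Y = F w l ** (mat 1 + smat \<i> (smat \<i> sigma3)) ** hconj (F w (- \<i> * l))"
    unfolding Xmat_eq[of F w l, OF assms] Ymat_eq[of F w l, OF assms]
    by (simp add: matrix_add_ldistrib matrix_add_rdistrib)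
  also have "det \<dots> = 0"
    by (simp add: det_mul) (simp add: sigma3_def det_2 mat2_simps)
  finally show ?thesis by simp
qed

text \<open>A zero lift would make the first row of \<open>Xmat\<close> vanish, against its
  determinant 1.\<close>

lemma fhat_nonzero:
  assumes "F w l \<in> SU2" "F w (- \<i> * l) \<in> SU2"
  shows "fhat F l w \<noteq> 0"
proof
  assume "fhat F l w = 0"
  hence "mat_to_quat (Xmat F l w) $ k = 0" for k
    using fhat_nth[of F l w k] by (simp add: complex_eq_iff)
  from this[of 1] this[of 2] this[of 3] this[of 4]
  have "Xmat F l w $ 1 $ 1 = 0" "Xmat F l w $ 1 $ 2 = 0"
    by (simp_all add: complex_eq_iff)
  moreover have "Xmat F l w \<in> SU2"
    using assms by (simp add: Xmat_eq SU2_mult hconj_SU2(3))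
  ultimately show False by (simp add: SU2_iff det_2)
qed

text \<open>Homogeneity over the complex numbers lets \<open>psiC\<close> map lines to lines, hence
  act on projective space.\<close>

lemma psiC_smult: "psiC p q (k *s v) = k *s psiC p q v"
  by (auto simp: psiC_def psi_def quat_to_mat_def hconj_def transpose_def
      map_matrix_def matrix_matrix_mult_def sum_2 vec_eq_iff forall_4 complex_eq_iff algebra_simps)

lemma psi_scaleR: "psi p q (r *\<^sub>R x) = r *\<^sub>R psi p q x"
  by (auto simp: psi_def quat_to_mat_def hconj_def transpose_def
      map_matrix_def matrix_matrix_mult_def sum_2 vec_eq_iff forall_4 algebra_simps)

text \<open>Up to the factor \<open>1 / sqrt 2\<close>, the real and imaginary parts of the lift are
  \<open>Xmat\<close> and \<open>Ymat\<close> read as quaternions, and \<open>psi\<close> multiplies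
  each by \<open>p\<close> and \<open>hconj q\<close>.\<close>

lemma psiC_fhat:
  assumes SU: "F w l \<in> SU2" "F w (- \<i> * l) \<in> SU2"
    and X: "Xmat F l w' = p ** Xmat F l w ** hconj q"
    and Y: "Ymat F l w' = p ** Ymat F l w ** hconj q"
  shows "fhat F l w' = psiC p q (fhat F l w)"
proof -
  have Re: "(\<chi> j. Re (fhat F l w $ j)) = (1 / sqrt 2) *\<^sub>R mat_to_quat (Xmat F l w)"
    and Im: "(\<chi> j. Im (fhat F l w $ j)) = (1 / sqrt 2) *\<^sub>R mat_to_quat (Ymat F l w)"
    by (simp_all add: fhat_nth vec_eq_iff)
  have "psi p q (mat_to_quat (Xmat F l w)) = mat_to_quat (Xmat F l w')"
    "psi p q (mat_to_quat (Ymat F l w)) = mat_to_quat (Ymat F l w')"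
    using quaternionic_X_Y[of F w l, OF SU] by (simp_all add: psi_def quat_to_mat_mat_to_quat X Y)
  thus ?thesis
    unfolding psiC_def Re Im psi_scaleR by (simp add: vec_eq_iff fhat_nth complex_eq_iff)
qed

theorem proposition3p2:
  fixes a b c :: real and F :: "complex \<Rightarrow> complex \<Rightarrow> complex^2^2"
  assumes "extended_frame a b c F"
  shows "\<forall>l \<in> sphere 0 1. \<forall>w :: complex.
    surface F l w \<in> Q2 \<and>
    (\<forall>\<theta> :: real.
      fhat F l (w + \<i> * complex_of_real \<theta>) =
        psiC (mexp (smat (\<i> * complex_of_real \<theta>) (Dmat a b c l)))
             (mexp (smat (\<i> * complex_of_real \<theta>) (Dmat a b c (- \<i> * l))))
             (fhat F l w) \<and>
      surface F l (w + \<i> * complex_of_real \<theta>) =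
        psiC (mexp (smat (\<i> * complex_of_real \<theta>) (Dmat a b c l)))
             (mexp (smat (\<i> * complex_of_real \<theta>) (Dmat a b c (- \<i> * l)))) ` surface F l w)"
proof (intro ballI allI conjI)
  fix l w :: complex assume l: "l \<in> sphere 0 1"
  hence l': "- \<i> * l \<in> sphere 0 1" by (simp add: norm_mult)
  note SU = extended_frame_SU2[OF assms l] extended_frame_SU2[OF assms l']
  show "surface F l w \<in> Q2"
    unfolding surface_def Q2_def using fhat_nonzero[of F w l, OF SU] sum_power2_fhat[of F w l, OF SU] by blast
  fix \<theta> :: real
  let ?w = "w + \<i> * complex_of_real \<theta>"
  let ?p = "mexp (smat (\<i> * complex_of_real \<theta>) (Dmat a b c l))"
  let ?q = "mexp (smat (\<i> * complex_of_real \<theta>) (Dmat a b c (- \<i> * l)))"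
  note rotate = extended_frame_rotate[OF assms l, of w \<theta>] extended_frame_rotate[OF assms l', of w \<theta>]
  \<comment> \<open>At the parameter \<open>- \<i> * l\<close> the rotation factor sits left of the
    frame; the Hermitian transpose moves it to the far right as \<open>hconj ?q\<close>.\<close>
  have "Xmat F l ?w = ?p ** Xmat F l w ** hconj ?q" "Ymat F l ?w = ?p ** Ymat F l w ** hconj ?q"
    unfolding Xmat_eq[of F _ l, OF SU] Ymat_eq[of F _ l, OF SU] rotate hconj_mult
    by (simp_all only: matrix_mul_assoc)
  thus fhat: "fhat F l ?w = psiC ?p ?q (fhat F l w)"
    by (rule psiC_fhat[of F w l, OF SU])
  show "surface F l ?w = psiC ?p ?q ` surface F l w"
    by (simp add: surface_def proj_def fhat image_image psiC_smult)
qed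

end
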